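(* Let $(E,\tau)$ be a real topological linear space, $\psi:E\to\mathbb{R}$ a seminorm, $K, A\subseteq E$ nontrivial cones with normlike-bases $B_K$ and $B_A$ (with respect to $\psi$), and let $K$ be pointed. Define $S_{-K}:=\mathrm{conv}(-B_K)$ and $S_A^0:=\mathrm{conv}(B_A\cup\{0\})$. Assume that there exists $(x^*,\alpha)\in K_\tau^{a\#}$ with $$x^*(a)+\alpha\psi(a)\ \geq\ 0\ >\ x^*(k)+\alpha\psi(k)\quad\text{for all } a\in A\text{ and }k\in -K\setminus\{0\}.$$ Suppose further that one of the following conditions is fulfilled: $1^\circ$ $B_K$ is $\tau$-compact; $2^\circ$ $\mathrm{cl}_\tau\,S_{-K}$ is $\tau$-compact, $0\notin\mathrm{cl}_\tau\,S_{-K}$ (e.g., if $\alpha>0$ or $B_K$ is $\tau$-compact), $\psi$ is $\tau$-continuous, and $K$ is $\tau$-closed and convex. Then $(\mathrm{cl}_\tau\,S_A^0)\cap(\mathrm{cl}_\tau\,S_{-K})=\emptyset$.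
   Context: $E\neq\{0\}$; $E'$ is the algebraic dual and $E^*=(E,\tau)^*$ the topological dual; $\mathbb{R}_+=[0,\infty)$. A set $K\subseteq E$ is a cone if $0\in K=\mathbb{R}_+\cdot K$ (not necessarily convex); it is nontrivial if $\{0\}\neq K\neq E$, pointed if $K\cap(-K)=\{0\}$. A seminorm is a sublinear symmetric function $\psi:E\to\mathbb{R}$ (not assumed $\tau$-continuous unless stated). A nontrivial cone $K$ has a normlike-base (w.r.t. $\psi$) if $\psi(x)>0$ for all $x\in K\setminus\{0\}$; the normlike-base is then $B_K:=\{x\in K\mid \psi(x)=1\}$. All normlike-bases are taken with respect to the same fixed seminorm $\psi$. $\mathrm{cl}_\tau$ is $\tau$-closure, $\mathrm{conv}$ the convex hull; $\tau$-compact means every $\tau$-open cover has a finite subcover. $-K\setminus\{0\}$ means $(-K)\setminus\{0\}$. $K^\#:=\{y'\in E'\mid \forall k\in K\setminus\{0\}:\ y'(k)>0\}$, $K^{a\#}:=\{(x',\alpha)\in K^\#\times\mathbb{R}_+\mid \forall y\in K\setminus\{0\}:\ x'(y)-\alpha\psi(y)>0\}$, and $K_\tau^{a\#}:=K^{a\#}\cap(E^*\times\mathbb{R})$. *)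

theory Defs
  imports "HOL-Analysis.Analysis"
begin

text \<open>
  A real topological linear space is a real vector space with a topology, not assumed to be
  Hausdorff, that makes addition and scalar multiplication jointly continuous. Continuity of
  addition comes from \<^class>\<open>topological_ab_group_add\<close>; the library has no class for both.
\<close>

class real_topological_vector = real_vector + topological_ab_group_add +
  assumes tendsto_scaleR_Pair:
    "LIM p (nhds c \<times>\<^sub>F nhds x). fst p *\<^sub>R snd p :> nhds (c *\<^sub>R x)"

instance real_normed_vector \<subseteq> real_topological_vector
proof
  fix c :: real and x :: 'a
  show "LIM p (nhds c \<times>\<^sub>F nhds x). fst p *\<^sub>R snd p :> nhds (c *\<^sub>R x)"
    by (intro tendsto_scaleR filterlim_fst filterlim_snd)
qed

text \<open>Algebraic dual \<open>E'\<close> and topological dual \<open>E\<^sup>*\<close>.\<close>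

definition algebraic_dual :: "('a::real_vector \<Rightarrow> real) set"
  where "algebraic_dual = {f. linear f}"

definition topological_dual :: "('a::real_topological_vector \<Rightarrow> real) set"
  where "topological_dual = {f. linear f \<and> continuous_on UNIV f}"

definition seminorm :: "('a::real_vector \<Rightarrow> real) \<Rightarrow> bool"
  where "seminorm \<psi> \<longleftrightarrow>
    (\<forall>x y. \<psi> (x + y) \<le> \<psi> x + \<psi> y) \<and>
    (\<forall>t\<ge>0. \<forall>x. \<psi> (t *\<^sub>R x) = t * \<psi> x) \<and>
    (\<forall>x. \<psi> (- x) = \<psi> x)"

text \<open>
  The library's \<^const>\<open>cone\<close> holds of the empty set, which the condition \<open>0 \<in> K\<close> excludes;
  that is the only difference.
\<close>

definition zero_cone :: "'a::real_vector set \<Rightarrow> bool"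
  where "zero_cone K \<longleftrightarrow> 0 \<in> K \<and> K = {t *\<^sub>R x | t x. t \<ge> 0 \<and> x \<in> K}"

lemma zero_cone_iff_cone: "zero_cone K \<longleftrightarrow> cone K \<and> K \<noteq> {}"
proof
  assume "zero_cone K"
  then show "cone K \<and> K \<noteq> {}"
    unfolding zero_cone_def cone_def by blast
next
  assume K: "cone K \<and> K \<noteq> {}"
  then have "K = {t *\<^sub>R x | t x. t \<ge> 0 \<and> x \<in> K}"
    unfolding cone_def by (force intro: exI[of _ "1::real"])
  with K show "zero_cone K"
    unfolding zero_cone_def using cone_contains_0 by blast
qed

definition nontrivial_cone :: "'a::real_vector set \<Rightarrow> bool"
  where "nontrivial_cone K \<longleftrightarrow> zero_cone K \<and> K \<noteq> {0} \<and> K \<noteq> UNIV"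

definition pointed :: "'a::real_vector set \<Rightarrow> bool"
  where "pointed K \<longleftrightarrow> K \<inter> uminus ` K = {0}"

definition has_normlike_base :: "('a::real_vector \<Rightarrow> real) \<Rightarrow> 'a set \<Rightarrow> bool"
  where "has_normlike_base \<psi> K \<longleftrightarrow> (\<forall>x \<in> K - {0}. \<psi> x > 0)"

definition normlike_base :: "('a::real_vector \<Rightarrow> real) \<Rightarrow> 'a set \<Rightarrow> 'a set"
  where "normlike_base \<psi> K = {x \<in> K. \<psi> x = 1}"

text \<open>\<open>K\<^sup>#\<close>, \<open>K\<^sup>a\<^sup>#\<close> and \<open>K\<^sub>\<tau>\<^sup>a\<^sup>#\<close>.\<close>

definition sharp_dual :: "'a::real_vector set \<Rightarrow> ('a \<Rightarrow> real) set"
  where "sharp_dual K = {y' \<in> algebraic_dual. \<forall>k \<in> K - {0}. y' k > 0}"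

definition aug_dual :: "('a::real_vector \<Rightarrow> real) \<Rightarrow> 'a set \<Rightarrow> (('a \<Rightarrow> real) \<times> real) set"
  where "aug_dual \<psi> K =
    {(x', \<alpha>) \<in> sharp_dual K \<times> {0..}. \<forall>y \<in> K - {0}. x' y - \<alpha> * \<psi> y > 0}"

definition aug_dual_top ::
    "('a::real_topological_vector \<Rightarrow> real) \<Rightarrow> 'a set \<Rightarrow> (('a \<Rightarrow> real) \<times> real) set"
  where "aug_dual_top \<psi> K = aug_dual \<psi> K \<inter> (topological_dual \<times> UNIV)"

text \<open>\<open>S\<^sub>-\<^sub>K\<close> (the argument is \<open>K\<close>, not \<open>-K\<close>) and \<open>S\<^sub>A\<^sup>0\<close>.\<close>

definition S_minus :: "('a::real_vector \<Rightarrow> real) \<Rightarrow> 'a set \<Rightarrow> 'a set"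
  where "S_minus \<psi> K = convex hull (uminus ` normlike_base \<psi> K)"

definition S_zero :: "('a::real_vector \<Rightarrow> real) \<Rightarrow> 'a set \<Rightarrow> 'a set"
  where "S_zero \<psi> A = convex hull (normlike_base \<psi> A \<union> {0})"

end

(* The level -alpha of x' separates the two sets: x' >= -alpha on S_A^0, while x' < -alpha on -B_K.
   If B_K is compact, then x' attains its minimum on B_K, so the second bound holds with a uniform
   gap, and the gap survives convex hull and closure. Condition 2 reduces to condition 1: there B_K
   is closed, and it is contained in the compact set -cl S_{-K}. *)

theory Submission
  imports Defs
begin

lemma seminorm_zero: "seminorm \<psi> \<Longrightarrow> \<psi> 0 = 0"
  unfolding seminorm_def by (metis mult_zero_left order_refl scaleR_zero_left)

text \<open>Any nonzero point of the cone lands in the base after division by its positive seminorm.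
  This supplies the nonemptiness needed for a minimum to be attained.\<close>

lemma normlike_base_nonempty:
  assumes "seminorm \<psi>" and "nontrivial_cone K" and "has_normlike_base \<psi> K"
  shows "normlike_base \<psi> K \<noteq> {}"
proof -
  from assms(2) obtain x where x: "x \<in> K" "x \<noteq> 0"
    unfolding nontrivial_cone_def zero_cone_def by blast
  with assms(3) have pos: "\<psi> x > 0"
    unfolding has_normlike_base_def by blast
  have "cone K"
    using assms(2) unfolding nontrivial_cone_def zero_cone_iff_cone by blast
  with x pos have "(1 / \<psi> x) *\<^sub>R x \<in> K"
    by (simp add: mem_cone)
  moreover have "\<psi> ((1 / \<psi> x) *\<^sub>R x) = 1 / \<psi> x * \<psi> x"
    using assms(1) pos unfolding seminorm_def by (simp del: times_divide_eq_left)
  ultimately show ?thesis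
    using pos unfolding normlike_base_def by auto
qed

lemma convex_hull_le_linear:
  fixes f :: "'a::real_vector \<Rightarrow> real"
  assumes "linear f" and "\<And>x. x \<in> S \<Longrightarrow> f x \<le> c"
  shows "convex hull S \<subseteq> {x. f x \<le> c}"
proof (rule hull_minimal)
  have "convex (f -` {..c})"
    using assms(1) by (rule convex_linear_vimage) simp
  then show "convex {x. f x \<le> c}"
    by (simp add: vimage_def)
qed (use assms(2) in blast)

text \<open>A closed half-space is convex and closed, so a bound checked on generators passes to the
  closed convex hull. The inequality is non-strict because a strict one could be lost in the
  closure.\<close>

lemma closure_convex_hull_le_linear:
  fixes f :: "'a::real_topological_vector \<Rightarrow> real"
  assumes "f \<in> topological_dual" and "\<And>x. x \<in> S \<Longrightarrow> f x \<le> c"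
  shows "closure (convex hull S) \<subseteq> {x. f x \<le> c}"
proof (rule closure_minimal)
  show "convex hull S \<subseteq> {x. f x \<le> c}"
    using assms by (intro convex_hull_le_linear) (auto simp: topological_dual_def)
  show "closed {x. f x \<le> c}"
    using assms(1) by (intro closed_Collect_le) (auto simp: topological_dual_def)
qed

lemma compact_normlike_base:
  fixes K :: "'a::real_topological_vector set"
  assumes "compact (closure (S_minus \<psi> K))" and "continuous_on UNIV \<psi>" and "closed K"
  shows "compact (normlike_base \<psi> K)"
proof -
  have "closed {x. \<psi> x = 1}"
    using assms(2) by (intro closed_Collect_eq) auto
  moreover have "normlike_base \<psi> K = K \<inter> {x. \<psi> x = 1}"
    unfolding normlike_base_def by auto
  ultimately have "closed (normlike_base \<psi> K)"
    using assms(3) by auto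
  moreover have "compact (uminus ` closure (S_minus \<psi> K))"
    using assms(1) by (intro compact_continuous_image continuous_intros)
  moreover have "normlike_base \<psi> K \<subseteq> uminus ` closure (S_minus \<psi> K)"
  proof
    fix b assume "b \<in> normlike_base \<psi> K"
    then have "- b \<in> closure (S_minus \<psi> K)"
      unfolding S_minus_def by (intro subsetD[OF closure_subset] hull_inc imageI)
    then show "b \<in> uminus ` closure (S_minus \<psi> K)"
      by (rule rev_image_eqI) simp
  qed
  \<comment> \<open>The topology need not be Hausdorff, so compact sets need not be closed; the base
    is obtained as the intersection of a compact set with a closed one.\<close>
  ultimately show ?thesis
    using compact_Int_closed[of "uminus ` closure (S_minus \<psi> K)" "normlike_base \<psi> K"]
    by (simp add: Int_absorb1)
qed

theorem theorem5p12:
  fixes \<psi> :: "'a::real_topological_vector \<Rightarrow> real"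
    and K A :: "'a set"
  assumes "(UNIV :: 'a set) \<noteq> {0}"
    and "seminorm \<psi>"
    and "nontrivial_cone K" and "has_normlike_base \<psi> K"
    and "nontrivial_cone A" and "has_normlike_base \<psi> A"
    and "pointed K"
    and "\<exists>(x', \<alpha>) \<in> aug_dual_top \<psi> K.
           (\<forall>a \<in> A. x' a + \<alpha> * \<psi> a \<ge> 0) \<and>
           (\<forall>k \<in> uminus ` K - {0}. 0 > x' k + \<alpha> * \<psi> k)"
    and "compact (normlike_base \<psi> K) \<or>
         (compact (closure (S_minus \<psi> K)) \<and> 0 \<notin> closure (S_minus \<psi> K) \<and>
          continuous_on UNIV \<psi> \<and> closed K \<and> convex K)"
  shows "closure (S_zero \<psi> A) \<inter> closure (S_minus \<psi> K) = {}"
proof -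
  from assms(8) obtain x' \<alpha> where dual: "x' \<in> topological_dual" and "\<alpha> \<ge> 0"
    and A: "\<And>a. a \<in> A \<Longrightarrow> x' a + \<alpha> * \<psi> a \<ge> 0"
    and K: "\<And>k. k \<in> uminus ` K - {0} \<Longrightarrow> x' k + \<alpha> * \<psi> k < 0"
    unfolding aug_dual_top_def aug_dual_def by auto
  have lin: "linear x'" and cont: "continuous_on UNIV x'"
    using dual unfolding topological_dual_def by auto
  \<comment> \<open>The half-space lemma gives upper bounds only; the lower bound for
    \<open>x'\<close> on the \<open>A\<close> side comes from applying it to the negated
    functional.\<close>
  have dual': "(\<lambda>x. - x' x) \<in> topological_dual"
    using lin cont unfolding topological_dual_def
    by (auto intro: linear_compose_neg continuous_on_minus)

  have "compact (normlike_base \<psi> K)"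
    using assms(9) compact_normlike_base by blast
  then obtain b where b: "b \<in> normlike_base \<psi> K"
    and b_min: "\<And>y. y \<in> normlike_base \<psi> K \<Longrightarrow> x' b \<le> x' y"
    using continuous_attains_inf[of "normlike_base \<psi> K" x'] cont
      normlike_base_nonempty[OF assms(2-4)] continuous_on_subset by blast
  \<comment> \<open>These facts allow the strict inequality to be evaluated at \<open>- b\<close>,
    where it reads \<open>- x' b + \<alpha> < 0\<close>.\<close>
  have "b \<noteq> 0" "\<psi> (- b) = 1" "b \<in> K"
    using b assms(2) seminorm_zero[OF assms(2)] unfolding normlike_base_def seminorm_def by auto
  then have gap: "\<alpha> < x' b"
    using K[of "- b"] by (simp add: linear_neg[OF lin])

  have "closure (S_minus \<psi> K) \<subseteq> {x. x' x \<le> - x' b}"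
    unfolding S_minus_def using b_min
    by (intro closure_convex_hull_le_linear dual) (auto simp: linear_neg[OF lin])
  moreover have "closure (S_zero \<psi> A) \<subseteq> {x. - x' x \<le> \<alpha>}"
    unfolding S_zero_def
  proof (intro closure_convex_hull_le_linear dual')
    \<comment> \<open>On the base, \<open>\<psi> x = 1\<close> turns the assumption on
      \<open>A\<close> into the bound; at the extra generator 0 the bound is just
      \<open>\<alpha> \<ge> 0\<close>.\<close>
    fix x assume "x \<in> normlike_base \<psi> A \<union> {0}"
    then show "- x' x \<le> \<alpha>"
      using A[of x] \<open>\<alpha> \<ge> 0\<close> linear_0[OF lin] unfolding normlike_base_def by auto
  qed
  \<comment> \<open>A common point would satisfy
    \<open>x' x \<le> - x' b < - \<alpha> \<le> x' x\<close>.\<close>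
  ultimately show ?thesis
    using gap by force
qed

end
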